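(* Let $k,\ell$ be integers with $k,\ell\geq 2$ and $2k\geq \ell$, and let $H$ be an arbitrary graph on $\ell$ vertices that contains a Hamiltonian cycle. Then $$C(C_{2k},H)=\frac{4k(k-1)}{2k\ell-2k-\ell}.$$
   Context: All graphs are finite and simple. $C_m$ denotes the cycle on $m$ vertices (with $C_2=K_2$ by convention). $\operatorname{hom}(H,T)$ is the number of maps $V(H)\to V(T)$ sending every edge of $H$ to an edge of $T$, $t(H,T)=\operatorname{hom}(H,T)/v(T)^{v(H)}$, and $C(G,H)=\min\{c\in\mathbb{R}: t(G,T)\geq t(H,T)^c \text{ for all graphs } T\}$. *)

theory Defs
  imports Complex_Main "HOL-Library.FuncSet" "Graph_Theory.Graph_Theory"
begin

text \<open>
  A finite simple graph is a \<^locale>\<open>pair_graph\<close>: a finite vertex set with a symmetric,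
  irreflexive set of arcs, so that an edge \<open>uv\<close> is the pair of arcs \<open>(u,v)\<close>, \<open>(v,u)\<close>.
\<close>

definition cycle_graph :: "nat \<Rightarrow> nat pair_pre_digraph" where
  "cycle_graph m =
     \<lparr> pverts = {..<m},
       parcs = {(u, v). u < m \<and> v < m \<and> (v = Suc u mod m \<or> u = Suc v mod m)} \<rparr>"

text \<open>
  In a symmetric digraph the library's \<^const>\<open>pre_digraph.cycle\<close> admits the closed walk
  \<open>a, b, a\<close>, so a graph on two vertices is Hamiltonian iff it is \<open>K\<^sub>2\<close>; this is the convention
  \<open>C\<^sub>2 = K\<^sub>2\<close>. On at least three vertices a covering cycle is a Hamiltonian cycle
  in the usual sense.
\<close>

definition hamiltonian :: "'a pair_pre_digraph \<Rightarrow> bool" where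
  "hamiltonian H \<longleftrightarrow>
     (\<exists>p. pre_digraph.cycle (with_proj H) p \<and> fst ` set p = pverts H)"

definition graph_homs :: "'a pair_pre_digraph \<Rightarrow> 'b pair_pre_digraph \<Rightarrow> ('a \<Rightarrow> 'b) set" where
  "graph_homs H T =
     {f \<in> pverts H \<rightarrow>\<^sub>E pverts T. \<forall>(u, v) \<in> parcs H. (f u, f v) \<in> parcs T}"

definition hom_count :: "'a pair_pre_digraph \<Rightarrow> 'b pair_pre_digraph \<Rightarrow> nat" where
  "hom_count H T = card (graph_homs H T)"

definition hom_density :: "'a pair_pre_digraph \<Rightarrow> 'b pair_pre_digraph \<Rightarrow> real" where
  "hom_density H T =
     real (hom_count H T) / real (card (pverts T)) ^ card (pverts H)"

text \<open>
  Target graphs are taken with vertices in \<^typ>\<open>nat\<close>, which is no loss of generality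
  (see \<open>admissible_exponents_any_type\<close> below), and are nonempty so that densities make sense.
  Note \<^term>\<open>0 powr c = 0\<close> for every \<^term>\<open>c\<close>. For \<^term>\<open>c > 0\<close> this is the usual value. An exponent
  \<^term>\<open>c \<le> 0\<close> is never admissible when \<open>G\<close> and \<open>H\<close> have an edge, whatever \<open>0\<^sup>c\<close> means: for a
  large complete graph \<open>T\<close> both densities lie strictly between 0 and 1.
\<close>

definition admissible_exponents :: "'a pair_pre_digraph \<Rightarrow> 'b pair_pre_digraph \<Rightarrow> real set" where
  "admissible_exponents G H =
     {c. \<forall>T :: nat pair_pre_digraph. pair_graph T \<longrightarrow> pverts T \<noteq> {} \<longrightarrow>
           hom_density G T \<ge> hom_density H T powr c}"

definition domination_exponent :: "'a pair_pre_digraph \<Rightarrow> 'b pair_pre_digraph \<Rightarrow> real" where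
  "domination_exponent G H = (LEAST c. c \<in> admissible_exponents G H)"

lemma pair_graph_cycle_graph:
  assumes "m \<ge> 2"
  shows "pair_graph (cycle_graph m)"
proof -
  have ne: "Suc u mod m \<noteq> u" if "u < m" for u
    using that assms by (cases "Suc u = m") auto
  have "finite (parcs (cycle_graph m))"
    by (rule finite_subset[of _ "{..<m} \<times> {..<m}"]) (auto simp: cycle_graph_def)
  then show ?thesis
    using ne ne[symmetric]
    by unfold_locales (auto simp: cycle_graph_def symmetric_def intro!: symI)
qed

lemma cycle_graph_2: "parcs (cycle_graph 2) = {(0, 1), (1, 0)}"
  by (auto simp: cycle_graph_def less_2_cases_iff)

lemma hom_density_iso:
  assumes H: "pair_graph H" and g: "bij_betw g (pverts T) (pverts T')"
    and arcs: "\<And>u v. u \<in> pverts T \<Longrightarrow> v \<in> pverts T \<Longrightarrow>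
                 (g u, g v) \<in> parcs T' \<longleftrightarrow> (u, v) \<in> parcs T"
  shows "hom_density H T = hom_density H T'"
proof -
  interpret H: pair_graph H by fact
  let ?F = "\<lambda>f. restrict (g \<circ> f) (pverts H)"
  have inj: "inj_on g (pverts T)" and im: "g ` pverts T = pverts T'"
    using g by (auto simp: bij_betw_def)
  have "bij_betw ?F (graph_homs H T) (graph_homs H T')"
  proof (rule bij_betw_imageI)
    show "inj_on ?F (graph_homs H T)"
    proof (rule inj_onI)
      fix f f' assume f: "f \<in> graph_homs H T" "f' \<in> graph_homs H T" and eq: "?F f = ?F f'"
      show "f = f'"
      proof (rule PiE_ext)
        show "f \<in> pverts H \<rightarrow>\<^sub>E pverts T" "f' \<in> pverts H \<rightarrow>\<^sub>E pverts T"
          using f by (auto simp: graph_homs_def)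
        fix x assume x: "x \<in> pverts H"
        have "g (f x) = g (f' x)"
          using fun_cong[OF eq, of x] x by simp
        moreover have "f x \<in> pverts T" "f' x \<in> pverts T"
          using f x by (auto simp: graph_homs_def)
        ultimately show "f x = f' x"
          using inj by (auto dest: inj_onD)
      qed
    qed
    show "?F ` graph_homs H T = graph_homs H T'"
    proof (intro equalityI subsetI)
      fix h assume "h \<in> ?F ` graph_homs H T"
      then obtain f where f: "f \<in> pverts H \<rightarrow>\<^sub>E pverts T"
        and e: "\<And>u v. (u, v) \<in> parcs H \<Longrightarrow> (f u, f v) \<in> parcs T" and h: "h = ?F f"
        unfolding graph_homs_def by fast
      have m: "f x \<in> pverts T" if "x \<in> pverts H" for x
        using f that by auto
      have "(h u, h v) \<in> parcs T'" if "(u, v) \<in> parcs H" for u v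
        using e[OF that] arcs m H.in_arcsD1[OF that] H.in_arcsD2[OF that] by (simp add: h)
      moreover have "h \<in> pverts H \<rightarrow>\<^sub>E pverts T'"
        using m im by (auto simp: h)
      ultimately show "h \<in> graph_homs H T'"
        by (auto simp: graph_homs_def)
    next
      fix h assume hh: "h \<in> graph_homs H T'"
      then have h: "h \<in> pverts H \<rightarrow>\<^sub>E pverts T'"
        and e: "\<And>u v. (u, v) \<in> parcs H \<Longrightarrow> (h u, h v) \<in> parcs T'"
        by (auto simp: graph_homs_def)
      define f where "f = restrict (inv_into (pverts T) g \<circ> h) (pverts H)"
      have f: "f x \<in> pverts T" "g (f x) = h x" if "x \<in> pverts H" for x
      proof -
        have "h x \<in> g ` pverts T" using h that im by auto
        then show "f x \<in> pverts T" "g (f x) = h x"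
          using that by (auto simp: f_def inv_into_into f_inv_into_f)
      qed
      have "(f u, f v) \<in> parcs T" if "(u, v) \<in> parcs H" for u v
        using e[OF that] arcs[of "f u" "f v"] f H.in_arcsD1[OF that] H.in_arcsD2[OF that] by simp
      moreover have "f \<in> pverts H \<rightarrow>\<^sub>E pverts T"
        using f by (auto simp: f_def)
      ultimately have "f \<in> graph_homs H T"
        by (auto simp: graph_homs_def)
      moreover have "?F f = h"
      proof
        fix x show "?F f x = h x"
          using f h by (cases "x \<in> pverts H") (auto simp: PiE_def extensional_def)
      qed
      ultimately show "h \<in> ?F ` graph_homs H T" by force
    qed
  qed
  then show ?thesis
    using bij_betw_same_card[OF g]
    by (simp add: hom_density_def hom_count_def bij_betw_same_card)
qed

lemma admissible_exponents_any_type: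
  fixes T :: "'c pair_pre_digraph"
  assumes "pair_graph G" "pair_graph H" "pair_graph T" "pverts T \<noteq> {}"
    and c: "c \<in> admissible_exponents G H"
  shows "hom_density G T \<ge> hom_density H T powr c"
proof -
  interpret T: pair_graph T by fact
  obtain g :: "'c \<Rightarrow> nat" where inj: "inj_on g (pverts T)"
    using T.pair_finite_verts finite_imp_inj_to_nat_seg by metis
  define T' where "T' = \<lparr> pverts = g ` pverts T, parcs = map_prod g g ` parcs T \<rparr>"
  have bij: "bij_betw g (pverts T) (pverts T')"
    using inj by (simp add: T'_def bij_betw_def)
  have arcs: "(g u, g v) \<in> parcs T' \<longleftrightarrow> (u, v) \<in> parcs T"
    if "u \<in> pverts T" "v \<in> pverts T" for u v
    using that inj by (auto simp: T'_def dest: inj_onD T.in_arcsD1 T.in_arcsD2)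
  have "sym (parcs T)"
    using T.pair_sym_arcs by (simp add: symmetric_def)
  then have "sym (parcs T')"
    by (auto simp: T'_def sym_def)
  moreover have "g u \<noteq> g v" if "(u, v) \<in> parcs T" for u v
    using T.no_loops'[OF that] inj T.in_arcsD1[OF that] T.in_arcsD2[OF that] by (auto dest: inj_onD)
  ultimately have "pair_graph T'"
    using T.pair_finite_verts T.pair_finite_arcs
    by unfold_locales (auto simp: T'_def symmetric_def dest: T.in_arcsD1 T.in_arcsD2)
  moreover have "pverts T' \<noteq> {}"
    using assms(4) by (simp add: T'_def)
  ultimately have "hom_density G T' \<ge> hom_density H T' powr c"
    using c by (simp add: admissible_exponents_def)
  then show ?thesis
    using hom_density_iso[OF assms(1) bij arcs] hom_density_iso[OF assms(2) bij arcs] by simp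
qed

end

theory Submission
  imports Defs "HOL-Analysis.Convex" "HOL-Computational_Algebra.Primes"
begin

text \<open>
  Upper bound: let \<open>A\<close> be the adjacency matrix of \<open>T\<close> and \<open>u\<^sub>j = tr A\<^sup>j\<close>, so that \<open>u\<^sub>2\<^sub>k\<close> counts the
  homomorphisms from \<open>C\<^sub>2\<^sub>k\<close>, and \<open>u\<^sub>\<ell>\<close> bounds those from \<open>H\<close>. By Cauchy--Schwarz,
  \<open>u\<^sub>i\<^sub>+\<^sub>j\<^sup>2 \<le> u\<^sub>2\<^sub>i u\<^sub>2\<^sub>j\<close>, whence \<open>u\<^sub>\<ell>\<close> is at most the log-linear interpolation between \<open>u\<^sub>2\<close> and
  \<open>u\<^sub>2\<^sub>k\<close>. The same argument for \<open>w\<^sub>j = 1\<^sup>T A\<^sup>j 1\<close> together with \<open>w\<^sub>2\<^sub>k \<le> n u\<^sub>2\<^sub>k\<close> gives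
  \<open>u\<^sub>2\<^sub>k \<ge> (u\<^sub>2 / n)\<^sup>2\<^sup>k\<close>, which eliminates \<open>u\<^sub>2\<close>.

  Lower bound: equality requires \<open>u\<^sub>2\<^sub>k\<close> to come in equal parts from the main eigenvalue and from many
  equal eigenvalues, which is achieved by overlapping cliques: on the plane over \<open>\<int>/q\<close>,
  \<open>q = p\<^sup>2\<^sup>k\<^sup>-\<^sup>1\<close>, join two points spanning a line of slope in \<open>{0..<p}\<close>. Differences of slopes are
  units, so closed walks can be counted by linear algebra, and each line carries about \<open>q\<^sup>\<ell>\<close> copies
  of \<open>H\<close>.
\<close>

section \<open>Chord inequalities for convex and log-convex sequences\<close>

text \<open>Increments of \<open>f\<close> are nondecreasing, so the mean increment from 0 to
  \<open>j\<close> is at most every increment at \<open>n >= j\<close>. Adding this comparison to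
  the inequality for \<open>n\<close> gives the one for \<open>n + 1\<close>.\<close>

lemma convex_seq_chord:
  fixes f :: "nat \<Rightarrow> real"
  assumes conv: "\<And>i. 2 * f (Suc i) \<le> f i + f (i + 2)" and "j \<le> k"
  shows "real k * f j \<le> real (k - j) * f 0 + real j * f k"
proof -
  have mono: "f (Suc i) - f i \<le> f (Suc i') - f i'" if "i \<le> i'" for i i'
    using that
  proof (induction i' rule: dec_induct)
    case (step n)
    then show ?case using conv[of n] by simp
  qed simp
  have lower: "real j * (f (Suc j) - f j) \<ge> f j - f 0" for j
  proof -
    have "f j - f 0 = (\<Sum>i<j. f (Suc i) - f i)"
      by (simp add: sum_lessThan_telescope)
    also have "\<dots> \<le> (\<Sum>i<j. f (Suc j) - f j)"
      by (intro sum_mono mono) auto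
    finally show ?thesis by simp
  qed
  from \<open>j \<le> k\<close> show ?thesis
  proof (induction k rule: dec_induct)
    case base
    then show ?case by simp
  next
    case (step n)
    have "real j * (f n - f 0) \<le> real j * (real n * (f (Suc n) - f n))"
      by (intro mult_left_mono lower) simp
    moreover have "real j * (f (Suc n) - f n) \<ge> f j - f 0"
    proof -
      have "f j - f 0 \<le> real j * (f (Suc j) - f j)" by (rule lower)
      also have "\<dots> \<le> real j * (f (Suc n) - f n)"
        using step.hyps by (intro mult_left_mono mono) auto
      finally show ?thesis .
    qed
    ultimately show ?case
      using step by (simp add: of_nat_diff algebra_simps Suc_diff_le)
  qed
qed

text \<open>A positive square on the left forces both factors on the right to be nonzero, so
  positivity propagates. This keeps \<open>ln\<close> away from its default value at 0 in the later
  estimates.\<close>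

lemma log_convex_seq_pos:
  fixes m :: "nat \<Rightarrow> real"
  assumes "\<And>i. m i \<ge> 0" and lc: "\<And>i. (m (Suc i))\<^sup>2 \<le> m i * m (i + 2)"
    and "m 0 > 0" "m 1 > 0"
  shows "m i > 0"
proof -
  have "m i > 0 \<and> m (Suc i) > 0"
  proof (induction i)
    case (Suc i)
    then have "0 < m i * m (i + 2)"
      using lc[of i] by (smt (verit) zero_less_power2)
    with Suc show ?case by (simp add: zero_less_mult_iff)
  qed (use assms in simp)
  then show ?thesis ..
qed

lemma log_convex_seq_chord:
  fixes m :: "nat \<Rightarrow> real"
  assumes nn: "\<And>i. m i \<ge> 0" and lc: "\<And>i. (m (Suc i))\<^sup>2 \<le> m i * m (i + 2)"
    and pos: "m 0 > 0" "m 1 > 0" and "j \<le> k"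
  shows "real k * ln (m j) \<le> real (k - j) * ln (m 0) + real j * ln (m k)"
proof (rule convex_seq_chord)
  fix i
  note p = log_convex_seq_pos[of m, OF nn lc pos]
  have "ln ((m (Suc i))\<^sup>2) \<le> ln (m i * m (i + 2))"
    using lc[of i] p[of "Suc i"] p[of i] p[of "i + 2"] by (subst ln_le_cancel_iff) auto
  then show "2 * ln (m (Suc i)) \<le> ln (m i) + ln (m (i + 2))"
    using p[of "Suc i"] p[of i] p[of "i + 2"] by (simp add: ln_realpow ln_mult)
qed fact

section \<open>Walk counts as moments of the adjacency matrix\<close>

context pair_graph
begin

text \<open>This is the \<open>(x, y)\<close> entry of the power \<open>A^j\<close> of the adjacency
  matrix; real values make Cauchy-Schwarz directly applicable.\<close>

primrec nwalks :: "nat \<Rightarrow> 'a \<Rightarrow> 'a \<Rightarrow> real" where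
  "nwalks 0 x y = of_bool (x = y)"
| "nwalks (Suc j) x y = (\<Sum>z\<in>pverts G. of_bool ((x, z) \<in> parcs G) * nwalks j z y)"

lemma nwalks_1: "y \<in> pverts G \<Longrightarrow> nwalks (Suc 0) x y = of_bool ((x, y) \<in> parcs G)"
  by (simp add: of_bool_def if_distrib[of "\<lambda>u. _ * u"] cong: if_cong)

lemma nwalks_add:
  assumes "x \<in> pverts G"
  shows "nwalks (i + j) x y = (\<Sum>z\<in>pverts G. nwalks i x z * nwalks j z y)"
  using assms
proof (induction i arbitrary: x)
  case 0
  then show ?case
    by (simp add: of_bool_def if_distrib[of "\<lambda>u. u * _"] cong: if_cong)
next
  case (Suc i)
  have "nwalks (Suc i + j) x y =
      (\<Sum>w\<in>pverts G. \<Sum>z\<in>pverts G. of_bool ((x, w) \<in> parcs G) * nwalks i w z * nwalks j z y)"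
    using Suc by (simp add: sum_distrib_left mult.assoc)
  also have "\<dots> = (\<Sum>z\<in>pverts G. \<Sum>w\<in>pverts G. of_bool ((x, w) \<in> parcs G) * nwalks i w z * nwalks j z y)"
    by (rule sum.swap)
  finally show ?case by (simp only: nwalks.simps sum_distrib_right)
qed

lemma parcs_sym: "(u, v) \<in> parcs G \<longleftrightarrow> (v, u) \<in> parcs G"
  using pair_sym_arcs by (auto simp: symmetric_def sym_def)

lemma nwalks_sym:
  assumes "x \<in> pverts G" "y \<in> pverts G"
  shows "nwalks j x y = nwalks j y x"
  using assms
proof (induction j arbitrary: x y)
  case (Suc j)
  have "nwalks (Suc j) x y = (\<Sum>z\<in>pverts G. nwalks j y z * nwalks (Suc 0) z x)"
    using Suc by (auto simp only: nwalks.simps(2)[of j] nwalks_1 parcs_sym[of x] mult.commute intro!: sum.cong)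
  also have "\<dots> = nwalks (j + Suc 0) y x"
    using Suc by (simp only: nwalks_add)
  finally show ?case by simp
qed auto

lemma nwalks_nonneg: "nwalks j x y \<ge> 0"
  by (induction j arbitrary: x) (auto intro!: sum_nonneg)

definition closed_walks :: "nat \<Rightarrow> real" where
  "closed_walks j = (\<Sum>x\<in>pverts G. nwalks j x x)"

definition all_walks :: "nat \<Rightarrow> real" where
  "all_walks j = (\<Sum>x\<in>pverts G. \<Sum>y\<in>pverts G. nwalks j x y)"

text \<open>Since A is symmetric, the trace of \<open>A^i A^j\<close> is the entrywise inner product
  of \<open>A^i\<close> and \<open>A^j\<close>. Cauchy-Schwarz for this inner product then bounds
  traces of odd powers too.\<close>

lemma closed_walks_add:
  "closed_walks (i + j) = (\<Sum>(x, y)\<in>pverts G \<times> pverts G. nwalks i x y * nwalks j x y)"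
  unfolding closed_walks_def sum.cartesian_product[symmetric]
  by (intro sum.cong) (auto simp: nwalks_add nwalks_sym intro!: sum.cong)

lemma closed_walks_square_le:
  "(closed_walks (i + j))\<^sup>2 \<le> closed_walks (2 * i) * closed_walks (2 * j)"
proof -
  have "closed_walks (2 * i) = (\<Sum>p\<in>pverts G \<times> pverts G. (nwalks i (fst p) (snd p))\<^sup>2)" for i
    using closed_walks_add[of i i] by (simp add: power2_eq_square case_prod_beta mult_2)
  then show ?thesis
    using Cauchy_Schwarz_ineq_sum[of "\<lambda>p. nwalks i (fst p) (snd p)" "\<lambda>p. nwalks j (fst p) (snd p)"
        "pverts G \<times> pverts G"]
    by (simp add: closed_walks_add case_prod_beta)
qed

lemma all_walks_add:
  "all_walks (i + j) =
     (\<Sum>z\<in>pverts G. (\<Sum>y\<in>pverts G. nwalks i z y) * (\<Sum>y\<in>pverts G. nwalks j z y))"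
proof -
  have "all_walks (i + j) = (\<Sum>x\<in>pverts G. \<Sum>y\<in>pverts G. \<Sum>z\<in>pverts G. nwalks i z x * nwalks j z y)"
    unfolding all_walks_def by (intro sum.cong) (auto simp: nwalks_add nwalks_sym intro!: sum.cong)
  also have "\<dots> = (\<Sum>x\<in>pverts G. \<Sum>z\<in>pverts G. \<Sum>y\<in>pverts G. nwalks i z x * nwalks j z y)"
    by (intro sum.cong refl sum.swap)
  also have "\<dots> = (\<Sum>z\<in>pverts G. \<Sum>x\<in>pverts G. \<Sum>y\<in>pverts G. nwalks i z x * nwalks j z y)"
    by (rule sum.swap)
  finally show ?thesis by (simp add: sum_product)
qed

lemma all_walks_square_le:
  "(all_walks (i + j))\<^sup>2 \<le> all_walks (2 * i) * all_walks (2 * j)"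
proof -
  have "all_walks (2 * i) = (\<Sum>z\<in>pverts G. (\<Sum>y\<in>pverts G. nwalks i z y)\<^sup>2)" for i
    using all_walks_add[of i i] by (simp add: power2_eq_square mult_2)
  then show ?thesis
    using Cauchy_Schwarz_ineq_sum[of "\<lambda>z. \<Sum>y\<in>pverts G. nwalks i z y"
        "\<lambda>z. \<Sum>y\<in>pverts G. nwalks j z y" "pverts G"]
    by (simp add: all_walks_add)
qed

lemma closed_walks_nonneg: "closed_walks j \<ge> 0"
  by (simp add: closed_walks_def sum_nonneg nwalks_nonneg)

lemma all_walks_nonneg: "all_walks j \<ge> 0"
  by (simp add: all_walks_def sum_nonneg nwalks_nonneg)

lemma all_walks_0: "all_walks 0 = card (pverts G)"
  by (simp add: all_walks_def of_bool_def)

text \<open>Entries of A are 0 or 1 and so equal their squares: both sides count arcs. This ties the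
  traces to the all-walk counts.\<close>

lemma closed_walks_2: "closed_walks 2 = all_walks 1"
proof -
  have "closed_walks 2 = (\<Sum>x\<in>pverts G. \<Sum>y\<in>pverts G. nwalks 1 x y * nwalks 1 x y)"
    using closed_walks_add[of 1 1] by (simp add: sum.cartesian_product numeral_2_eq_2)
  also have "\<dots> = all_walks 1"
    unfolding all_walks_def by (intro sum.cong) (auto simp: nwalks_1 simp del: nwalks.simps)
  finally show ?thesis .
qed

text \<open>With n vertices, the left side is the squared norm of \<open>A^j 1\<close>;
  Cauchy-Schwarz in each row against the all-ones vector bounds it by n times the sum of the squared
  entries of \<open>A^j\<close>.\<close>

lemma all_walks_even_le_closed_walks:
  "all_walks (2 * j) \<le> card (pverts G) * closed_walks (2 * j)"
proof -
  have "(\<Sum>y\<in>pverts G. nwalks j z y)\<^sup>2 \<le> card (pverts G) * (\<Sum>y\<in>pverts G. (nwalks j z y)\<^sup>2)" for z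
    using Cauchy_Schwarz_ineq_sum[of "\<lambda>_. 1" "nwalks j z" "pverts G"] by simp
  then have "(\<Sum>z\<in>pverts G. (\<Sum>y\<in>pverts G. nwalks j z y)\<^sup>2) \<le>
      (\<Sum>z\<in>pverts G. card (pverts G) * (\<Sum>y\<in>pverts G. (nwalks j z y)\<^sup>2))"
    by (intro sum_mono)
  then show ?thesis
    using all_walks_add[of j j] closed_walks_add[of j j]
    by (simp add: power2_eq_square mult_2 sum.cartesian_product[symmetric] flip: sum_distrib_left)
qed

text \<open>Write u, w for \<open>closed_walks\<close>, \<open>all_walks\<close> and n for the
  number of vertices. Log-convexity of w at even lengths, with \<open>w 0 = n\<close>, gives
  \<open>w (2k) >= n (w 2 / n)^k\<close>. Then use \<open>(u 2)^2 = (w 1)^2 <= n * w 2\<close> and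
  \<open>w (2k) <= n * u (2k)\<close>.\<close>

lemma closed_walks_even_ge:
  assumes ne: "closed_walks 2 > 0" and "k \<ge> 1"
  shows "closed_walks (2 * k) > 0"
    and "2 * real k * (ln (closed_walks 2) - ln (real (card (pverts G)))) \<le> ln (closed_walks (2 * k))"
proof -
  let ?n = "real (card (pverts G))"
  let ?w = "\<lambda>i. all_walks (2 * i)"
  have n: "?n > 0"
    using ne by (auto simp: closed_walks_def card_gt_0_iff)
  have lc: "(?w (Suc i))\<^sup>2 \<le> ?w i * ?w (i + 2)" for i
    using all_walks_square_le[of i "i + 2"] by (simp add: mult_2)
  have w1: "(closed_walks 2)\<^sup>2 \<le> ?n * ?w 1"
    using all_walks_square_le[of 0 1] by (simp add: closed_walks_2 all_walks_0)
  then have "?n * ?w 1 > 0"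
    using ne by (smt (verit) zero_less_power2)
  then have p1: "?w 1 > 0"
    using n by (simp add: zero_less_mult_iff)
  have p0: "?w 0 > 0" using n by (simp add: all_walks_0)
  note pos = log_convex_seq_pos[of ?w, OF all_walks_nonneg lc p0 p1]
  have chord: "k * ln (?w 1) \<le> (real k - 1) * ln ?n + ln (?w k)"
    using log_convex_seq_chord[of ?w, OF all_walks_nonneg lc p0 p1 \<open>k \<ge> 1\<close>] \<open>k \<ge> 1\<close>
    by (simp add: all_walks_0 of_nat_diff)
  have le: "?w k \<le> ?n * closed_walks (2 * k)"
    by (rule all_walks_even_le_closed_walks)
  then have "?n * closed_walks (2 * k) > 0"
    using pos[of k] by linarith
  then show cpos: "closed_walks (2 * k) > 0"
    using n by (simp add: zero_less_mult_iff)
  have "ln (?w k) \<le> ln ?n + ln (closed_walks (2 * k))"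
    using le pos[of k] n cpos by (metis ln_le_cancel_iff ln_mult_pos mult_pos_pos)
  moreover have "ln ((closed_walks 2)\<^sup>2) \<le> ln (?n * ?w 1)"
    using w1 ne \<open>?n * ?w 1 > 0\<close> by (subst ln_le_cancel_iff) auto
  then have "2 * ln (closed_walks 2) \<le> ln ?n + ln (?w 1)"
    using ne n p1 by (auto simp: ln_realpow ln_mult card_gt_0_iff)
  then have "k * (2 * ln (closed_walks 2)) \<le> k * (ln ?n + ln (?w 1))"
    by (intro mult_left_mono) auto
  ultimately show "2 * real k * (ln (closed_walks 2) - ln ?n) \<le> ln (closed_walks (2 * k))"
    using chord by (simp add: algebra_simps)
qed

text \<open>The index shift starts the chord at length 2 instead of 0, so that the left endpoint is
  the arc count.\<close>

lemma closed_walks_even_interpolation: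
  assumes ne: "closed_walks 2 > 0" and "1 \<le> j" "j \<le> k"
  shows "(real k - 1) * ln (closed_walks (2 * j)) \<le>
     (real k - real j) * ln (closed_walks 2) + (real j - 1) * ln (closed_walks (2 * k))"
proof -
  let ?m = "\<lambda>i. closed_walks (2 * Suc i)"
  have lc: "(?m (Suc i))\<^sup>2 \<le> ?m i * ?m (i + 2)" for i
    using closed_walks_square_le[of "Suc i" "Suc (i + 2)"] by (simp add: mult_2)
  have p: "?m 0 > 0" "?m 1 > 0"
    using closed_walks_even_ge(1)[OF ne, of 1] closed_walks_even_ge(1)[OF ne, of 2]
    by (simp_all add: numeral_eq_Suc)
  show ?thesis
    using log_convex_seq_chord[of ?m, OF closed_walks_nonneg lc p, of "j - 1" "k - 1"] assms
    by (simp add: of_nat_diff numeral_2_eq_2)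
qed

text \<open>An odd length is handled by the geometric mean of its two even neighbours; the chord is
  linear in the length, so averaging their two bounds gives exactly the bound at
  \<open>l\<close>.\<close>

lemma closed_walks_interpolation:
  assumes ne: "closed_walks 2 > 0" and "k \<ge> 2" "2 \<le> l" "l \<le> 2 * k" and pos: "closed_walks l > 0"
  shows "(2 * real k - 2) * ln (closed_walks l) \<le>
     (2 * real k - real l) * ln (closed_walks 2) + (real l - 2) * ln (closed_walks (2 * k))"
proof (cases "even l")
  case True
  then obtain j where "l = 2 * j" by blast
  then show ?thesis
    using closed_walks_even_interpolation[OF ne, of j k] assms by (simp add: algebra_simps)
next
  case False
  then obtain j where l: "l = 2 * j + 1" using oddE by blast
  have j: "1 \<le> j" "Suc j \<le> k" using assms l by auto
  have p: "closed_walks (2 * j) > 0" "closed_walks (2 * Suc j) > 0"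
    using closed_walks_even_ge(1)[OF ne, of j] closed_walks_even_ge(1)[OF ne, of "Suc j"] j by auto
  have "(closed_walks l)\<^sup>2 \<le> closed_walks (2 * j) * closed_walks (2 * Suc j)"
    using closed_walks_square_le[of j "Suc j"] by (simp add: l mult_2)
  then have "ln ((closed_walks l)\<^sup>2) \<le> ln (closed_walks (2 * j) * closed_walks (2 * Suc j))"
    using p pos by (subst ln_le_cancel_iff) auto
  then have "2 * ln (closed_walks l) \<le> ln (closed_walks (2 * j)) + ln (closed_walks (2 * Suc j))"
    using p pos by (simp add: ln_realpow ln_mult del: mult_Suc_right)
  then have "(real k - 1) * (2 * ln (closed_walks l)) \<le>
      (real k - 1) * (ln (closed_walks (2 * j)) + ln (closed_walks (2 * Suc j)))"
    using assms by (intro mult_left_mono) auto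
  then show ?thesis
    using closed_walks_even_interpolation[OF ne, of j k]
      closed_walks_even_interpolation[OF ne, of "Suc j" k] j
    by (simp add: l algebra_simps)
qed

end

section \<open>Homomorphisms versus closed walks\<close>

lemma successively_nth:
  "successively P xs \<longleftrightarrow> (\<forall>i. Suc i < length xs \<longrightarrow> P (xs ! i) (xs ! Suc i))"
proof (induction P xs rule: successively.induct)
  case (3 P x y xs)
  then show ?case by (auto simp: nth_Cons split: nat.splits)
qed auto

context pair_graph
begin

text \<open>The start is not repeated in the list; \<open>hd xs\<close> is appended only to test the
  closing arc. For \<open>m = 0\<close> the only member is the empty list, whereas
  \<open>closed_walks 0\<close> is the number of vertices, hence the hypothesis
  \<open>m >= 1\<close> below.\<close>

definition closed_walk_lists :: "nat \<Rightarrow> 'a list set" where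
  "closed_walk_lists m = {xs. set xs \<subseteq> pverts G \<and> length xs = m \<and>
     successively (\<lambda>u v. (u, v) \<in> parcs G) (xs @ [hd xs])}"

lemma finite_closed_walk_lists: "finite (closed_walk_lists m)"
  by (rule finite_subset[OF _ finite_lists_length_eq[OF pair_finite_verts, of m]])
     (auto simp: closed_walk_lists_def)

text \<open>The list holds only the interior vertices: \<open>j\<close> of them make a walk with
  \<open>j + 1\<close> arcs.\<close>

lemma card_walk_lists:
  assumes "y \<in> pverts G"
  shows "real (card {xs. set xs \<subseteq> pverts G \<and> length xs = j \<and>
      successively (\<lambda>u v. (u, v) \<in> parcs G) (x # xs @ [y])}) = nwalks (Suc j) x y"
proof (induction j arbitrary: x)
  case 0
  have "{xs. set xs \<subseteq> pverts G \<and> length xs = 0 \<and>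
      successively (\<lambda>u v. (u, v) \<in> parcs G) (x # xs @ [y])} = (if (x, y) \<in> parcs G then {[]} else {})"
    by auto
  then show ?case using assms by (simp add: nwalks_1 del: nwalks.simps)
next
  case (Suc j)
  let ?S = "\<lambda>j x. {xs. set xs \<subseteq> pverts G \<and> length xs = j \<and>
      successively (\<lambda>u v. (u, v) \<in> parcs G) (x # xs @ [y])}"
  let ?N = "{z \<in> pverts G. (x, z) \<in> parcs G}"
  have fin: "finite (?S j z)" for z
    by (rule finite_subset[OF _ finite_lists_length_eq[OF pair_finite_verts, of j]]) auto
  have "?S (Suc j) x = (\<Union>z\<in>?N. Cons z ` ?S j z)"
    by (auto simp: length_Suc_conv image_iff)
  then have "card (?S (Suc j) x) = (\<Sum>z\<in>?N. card (Cons z ` ?S j z))"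
    using fin by (simp only:) (subst card_UN_disjoint, auto)
  also have "\<dots> = (\<Sum>z\<in>?N. card (?S j z))"
    by (simp add: card_image)
  finally have "real (card (?S (Suc j) x)) = (\<Sum>z\<in>?N. real (card (?S j z)))"
    by (simp only: of_nat_sum)
  also have "\<dots> = (\<Sum>z\<in>?N. nwalks (Suc j) z y)"
    by (simp only: Suc)
  also have "\<dots> = nwalks (Suc (Suc j)) x y"
    by (subst nwalks.simps(2)[of "Suc j"]) (auto simp del: nwalks.simps intro!: sum.mono_neutral_cong_left)
  finally show ?case .
qed

lemma card_closed_walk_lists:
  assumes "m \<ge> 1"
  shows "real (card (closed_walk_lists m)) = closed_walks m"
proof -
  obtain j where m: "m = Suc j" using assms by (cases m) auto
  let ?S = "\<lambda>x. {xs. set xs \<subseteq> pverts G \<and> length xs = j \<and>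
      successively (\<lambda>u v. (u, v) \<in> parcs G) (x # xs @ [x])}"
  have fin: "finite (?S x)" for x
    by (rule finite_subset[OF _ finite_lists_length_eq[OF pair_finite_verts, of j]]) auto
  have "closed_walk_lists m = (\<Union>x\<in>pverts G. Cons x ` ?S x)"
    by (auto simp: m closed_walk_lists_def length_Suc_conv image_iff)
  then have "card (closed_walk_lists m) = (\<Sum>x\<in>pverts G. card (Cons x ` ?S x))"
    using fin by (simp only:) (subst card_UN_disjoint, auto)
  also have "\<dots> = (\<Sum>x\<in>pverts G. card (?S x))"
    by (simp add: card_image)
  finally have "real (card (closed_walk_lists m)) = (\<Sum>x\<in>pverts G. real (card (?S x)))"
    by (simp only: of_nat_sum)
  then show ?thesis
    by (simp add: closed_walks_def m card_walk_lists del: nwalks.simps)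
qed

lemma hom_count_cycle_graph_ge:
  assumes "m \<ge> 1"
  shows "closed_walks m \<le> hom_count (cycle_graph m) G"
proof -
  let ?F = "\<lambda>xs. restrict ((!) xs) {..<m}"
  have fin: "finite (graph_homs (cycle_graph m) G)"
    by (rule finite_subset[of _ "{..<m} \<rightarrow>\<^sub>E pverts G"])
       (auto simp: graph_homs_def cycle_graph_def intro!: finite_PiE)
  have "inj_on ?F (closed_walk_lists m)"
  proof (rule inj_onI)
    fix xs ys assume a: "xs \<in> closed_walk_lists m" "ys \<in> closed_walk_lists m" "?F xs = ?F ys"
    have "xs ! i = ys ! i" if "i < m" for i
      using fun_cong[OF a(3), of i] that by simp
    with a(1,2) show "xs = ys"
      by (auto simp: closed_walk_lists_def intro: nth_equalityI)
  qed
  moreover have "?F xs \<in> graph_homs (cycle_graph m) G" if xs: "xs \<in> closed_walk_lists m" for xs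
  proof -
    have len: "length xs = m" and sub: "set xs \<subseteq> pverts G"
      using xs by (auto simp: closed_walk_lists_def)
    have hd0: "hd xs = xs ! 0"
      using len assms by (intro hd_conv_nth) auto
    have step: "(xs ! i, xs ! (Suc i mod m)) \<in> parcs G" if "i < m" for i
    proof -
      have "((xs @ [hd xs]) ! i, (xs @ [hd xs]) ! Suc i) \<in> parcs G"
        using xs that by (simp add: closed_walk_lists_def successively_nth)
      then show ?thesis
        using that len hd0 by (cases "Suc i = m") (auto simp: nth_append)
    qed
    then have "(xs ! (Suc i mod m), xs ! i) \<in> parcs G" if "i < m" for i
      using that parcs_sym by blast
    with step len sub show ?thesis
      by (auto simp: graph_homs_def cycle_graph_def)
  qed
  ultimately have "card (closed_walk_lists m) \<le> hom_count (cycle_graph m) G"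
    unfolding hom_count_def using fin by (intro card_inj_on_le[of ?F]) auto
  then show ?thesis
    using card_closed_walk_lists[OF assms] by linarith
qed

text \<open>The image of the covering closed walk is a closed walk in \<open>G\<close>, and it
  determines the homomorphism because every vertex of \<open>H\<close> is visited. Further edges of
  \<open>H\<close> only restrict the homomorphisms.\<close>

lemma hom_count_le_closed_walks:
  fixes H :: "'b pair_pre_digraph"
  assumes vs: "vs \<noteq> []" "set vs = pverts H"
    and cyc: "successively (\<lambda>u v. (u, v) \<in> parcs H) (vs @ [hd vs])"
  shows "hom_count H G \<le> closed_walks (length vs)"
proof -
  have "inj_on (\<lambda>f. map f vs) (graph_homs H G)"
    by (rule inj_onI, rule PiE_ext[of _ "pverts H" "\<lambda>_. pverts G"])
       (auto simp: graph_homs_def simp flip: vs(2))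
  moreover have "map f vs \<in> closed_walk_lists (length vs)" if f: "f \<in> graph_homs H G" for f
  proof -
    have "successively (\<lambda>u v. (f u, f v) \<in> parcs G) (vs @ [hd vs])"
      by (rule successively_mono[OF cyc]) (use f in \<open>auto simp: graph_homs_def\<close>)
    then have "successively (\<lambda>u v. (u, v) \<in> parcs G) (map f (vs @ [hd vs]))"
      by (simp only: successively_map)
    then show ?thesis
      using f vs by (auto simp: closed_walk_lists_def graph_homs_def hd_map)
  qed
  ultimately have "hom_count H G \<le> card (closed_walk_lists (length vs))"
    unfolding hom_count_def by (intro card_inj_on_le[OF _ _ finite_closed_walk_lists]) auto
  then show ?thesis
    using card_closed_walk_lists[of "length vs"] vs by (cases vs) (simp_all flip: of_nat_le_iff)
qed

text \<open>Distinct heads of the arcs bound the length by the number of vertices, and covering by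
  the tails gives the converse bound.\<close>

lemma hamiltonian_closed_walk:
  assumes "hamiltonian G"
  obtains vs where "length vs = card (pverts G)" "set vs = pverts G" "vs \<noteq> []"
    "successively (\<lambda>u v. (u, v) \<in> parcs G) (vs @ [hd vs])"
proof -
  obtain p u where p: "awalk u p u" "distinct (tl (awalk_verts u p))" "p \<noteq> []"
    and cover: "fst ` set p = pverts G"
    using assms by (auto simp: hamiltonian_def cycle_def)
  have cas: "cas u p u" and sub: "set p \<subseteq> parcs G"
    using p(1) by (auto simp: awalk_def)
  have "distinct (map snd p)"
    using p(2,3) by (auto simp: awalk_verts_conv'[OF cas])
  moreover have "set (map snd p) \<subseteq> pverts G"
    using sub in_arcsD2 by fastforce
  ultimately have "length p \<le> card (pverts G)"
    using distinct_card[of "map snd p"] card_mono[OF pair_finite_verts, of "set (map snd p)"] by simp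
  moreover have "card (pverts G) \<le> length p"
    unfolding cover[symmetric] using card_length[of "map fst p"] by simp
  ultimately have len: "length (map fst p) = card (pverts G)"
    by simp
  have "successively (\<lambda>u v. (u, v) \<in> parcs G) (map fst q @ [v])" if "cas w q v" "set q \<subseteq> parcs G" for w q v
    using that
  proof (induction w q v rule: cas.induct)
    case (2 w e es v)
    then show ?case by (cases es) auto
  qed simp
  from this[OF cas sub] have "successively (\<lambda>u v. (u, v) \<in> parcs G) (map fst p @ [hd (map fst p)])"
    using cas p(3) by (cases p) auto
  then show thesis
    using that[of "map fst p"] len cover p(3) by simp
qed

end


section \<open>Upper bound for the exponent\<close>

lemma exponent_denominator_pos:
  assumes "k \<ge> 2" "l \<ge> (2::nat)"
  shows "2 * real k * real l - 2 * real k - real l > 0"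
proof -
  have "real l * (2 * real k - 1) \<ge> 2 * (2 * real k - 1)"
    using assms by (intro mult_right_mono) auto
  then show ?thesis using assms by (simp add: algebra_simps)
qed

lemma cycle_density_ge_hamiltonian_density_powr:
  fixes k l :: nat and H :: "'a pair_pre_digraph" and T :: "'b pair_pre_digraph"
  assumes k: "k \<ge> 2" and l: "l \<ge> 2" "l \<le> 2 * k"
    and "pair_graph H" "card (pverts H) = l" "hamiltonian H"
    and "pair_graph T" "pverts T \<noteq> {}"
  shows "hom_density H T powr (4 * real k * (real k - 1) / (2 * real k * real l - 2 * real k - real l))
       \<le> hom_density (cycle_graph (2 * k)) T"
proof -
  interpret H: pair_graph H by fact
  interpret T: pair_graph T by fact
  let ?n = "real (card (pverts T))"
  let ?c = "4 * real k * (real k - 1) / (2 * real k * real l - 2 * real k - real l)"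
  have n: "?n > 0"
    using \<open>pverts T \<noteq> {}\<close> by (simp add: card_gt_0_iff)
  note D = exponent_denominator_pos[OF k l(1)]
  obtain vs where vs: "length vs = card (pverts H)" "set vs = pverts H" "vs \<noteq> []"
    "successively (\<lambda>u v. (u, v) \<in> parcs H) (vs @ [hd vs])"
    using H.hamiltonian_closed_walk[OF \<open>hamiltonian H\<close>] .
  have up: "hom_count H T \<le> T.closed_walks l"
    using T.hom_count_le_closed_walks[OF vs(3,2,4)] vs(1) \<open>card (pverts H) = l\<close> by simp
  have low: "T.closed_walks (2 * k) \<le> hom_count (cycle_graph (2 * k)) T"
    using T.hom_count_cycle_graph_ge[of "2 * k"] k by simp
  show ?thesis
  proof (cases "hom_count H T = 0")
    case True
    then show ?thesis by (simp add: hom_density_def)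
  next
    case False
    then have posl: "T.closed_walks l > 0" using up by linarith
    \<comment> \<open>Without arcs there are no closed walks of length \<open>l\<close>: split
      \<open>l = 1 + (l - 1)\<close> in Cauchy-Schwarz.\<close>
    have "T.closed_walks 2 \<noteq> 0"
    proof
      assume "T.closed_walks 2 = 0"
      then have "(T.closed_walks l)\<^sup>2 \<le> 0"
        using T.closed_walks_square_le[of 1 "l - 1"] l by simp
      with posl show False by simp
    qed
    then have ne: "T.closed_walks 2 > 0"
      using T.closed_walks_nonneg[of 2] by linarith
    define L where "L = ln ?n"
    define x where "x = ln (T.closed_walks 2)"
    define y where "y = ln (T.closed_walks (2 * k))"
    define z where "z = ln (T.closed_walks l)"
    have posk: "T.closed_walks (2 * k) > 0"
      using T.closed_walks_even_ge(1)[OF ne] k by simp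
    have xy: "2 * k * (x - L) \<le> y"
      using T.closed_walks_even_ge(2)[OF ne, of k] k by (simp add: x_def y_def L_def)
    have interp: "(2 * real k - 2) * z \<le> (2 * real k - real l) * x + (real l - 2) * y"
      using T.closed_walks_interpolation[OF ne k l posl] by (simp add: x_def y_def z_def)
    \<comment> \<open>The factor \<open>2 * k\<close> prepares the elimination of \<open>x\<close>
      through \<open>2 * k * x <= y + 2 * k * L\<close>, whose coefficient \<open>2 * k - l\<close>
      is nonnegative by hypothesis.\<close>
    have "4 * real k * (real k - 1) * z \<le> 2 * real k * ((2 * real k - real l) * x + (real l - 2) * y)"
      using mult_left_mono[OF interp, of "2 * real k"] by (simp add: algebra_simps)
    also have "\<dots> \<le> (2 * real k - real l) * (y + 2 * real k * L) + 2 * real k * (real l - 2) * y"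
      using mult_left_mono[OF xy, of "2 * real k - real l"] l by (simp add: algebra_simps)
    \<comment> \<open>The coefficient of \<open>y\<close> is now the denominator of the exponent,
      and subtracting \<open>4 * k * (k - 1) * l * L\<close> makes the terms in \<open>L\<close> fit
      the same factor.\<close>
    finally have "4 * real k * (real k - 1) * (z - real l * L) \<le>
        (2 * real k * real l - 2 * real k - real l) * (y - 2 * real k * L)"
      by (simp add: algebra_simps)
    then have main: "?c * (z - real l * L) \<le> y - 2 * real k * L"
      using D by (simp add: field_simps)
    have "hom_density H T powr ?c \<le> (T.closed_walks l / ?n ^ l) powr ?c"
      using up n D k \<open>card (pverts H) = l\<close>
      by (intro powr_mono2) (auto simp: hom_density_def divide_right_mono)
    also have "\<dots> = exp (?c * (z - real l * L))"
      using posl n \<open>pverts T \<noteq> {}\<close> by (simp add: powr_def z_def L_def ln_div ln_realpow)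
    also have "\<dots> \<le> exp (y - 2 * real k * L)"
      using main by simp
    also have "\<dots> = exp (ln (T.closed_walks (2 * k) / ?n ^ (2 * k)))"
      using posk n by (subst ln_div) (auto simp: y_def L_def ln_realpow)
    also have "\<dots> = T.closed_walks (2 * k) / ?n ^ (2 * k)"
      using posk n by (intro exp_ln) simp
    also have "\<dots> \<le> hom_density (cycle_graph (2 * k)) T"
      using low by (simp add: hom_density_def cycle_graph_def divide_right_mono)
    finally show ?thesis .
  qed
qed

section \<open>The net graph of overlapping cliques and its homomorphism counts\<close>

text \<open>
  If differences of slopes are units modulo \<open>q\<close>, this is an edge-disjoint union of \<open>r q\<close> cliques of
  size \<open>q\<close>, one for each line with slope in \<open>{0..<r}\<close>.
\<close>

definition net_graph :: "nat \<Rightarrow> nat \<Rightarrow> (int \<times> int) pair_pre_digraph" where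
  "net_graph q r =
     \<lparr> pverts = {0..<int q} \<times> {0..<int q},
       parcs = {(u, v). u \<in> {0..<int q} \<times> {0..<int q} \<and> v \<in> {0..<int q} \<times> {0..<int q} \<and>
         fst u \<noteq> fst v \<and> (\<exists>s\<in>{0..<int r}. int q dvd snd v - snd u - s * (fst v - fst u))} \<rparr>"

lemma pverts_net_graph [simp]: "pverts (net_graph q r) = {0..<int q} \<times> {0..<int q}"
  by (simp add: net_graph_def)

lemma pair_graph_net_graph: "pair_graph (net_graph q r)"
proof -
  have "finite (parcs (net_graph q r))"
    by (rule finite_subset[of _ "pverts (net_graph q r) \<times> pverts (net_graph q r)"])
       (auto simp: net_graph_def)
  moreover have flip: "int q dvd snd u - snd v - s * (fst u - fst v)"
    if "int q dvd snd v - snd u - s * (fst v - fst u)" for u v :: "int \<times> int" and s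
    using that by (subst dvd_minus_iff[symmetric]) (simp add: algebra_simps)
  have "sym (parcs (net_graph q r))"
    by (rule symI) (use flip in \<open>simp add: net_graph_def, metis\<close>)
  ultimately show ?thesis
    by unfold_locales (auto simp: net_graph_def symmetric_def)
qed

lemma residue_eqI:
  fixes x y :: int
  assumes "int q dvd x - y" "x \<in> {0..<int q}" "y \<in> {0..<int q}"
  shows "x = y"
  using assms by (metis atLeastLessThan_iff mod_eq_dvd_iff mod_pos_pos_trivial)

text \<open>Coprimality, rather than mere distinctness modulo \<open>q\<close>, is what allows
  cancelling a slope difference: \<open>q\<close> will be a prime power, and the residues may have
  zero divisors.\<close>

locale slope_net =
  fixes q r :: nat
  assumes q_pos: "q > 0"
    and coprime_slopes: "\<And>s s'. s \<in> {0..<int r} \<Longrightarrow> s' \<in> {0..<int r} \<Longrightarrow> s \<noteq> s' \<Longrightarrow> coprime (int q) (s - s')"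
begin

text \<open>Prescribing a slope for each edge of the cycle and dropping the condition that adjacent
  first coordinates differ leaves a linear system modulo \<open>q\<close>. The enlargement is
  harmless for upper bounds.\<close>

definition slope_homs :: "nat \<Rightarrow> (nat \<Rightarrow> int) \<Rightarrow> (nat \<Rightarrow> int \<times> int) set" where
  "slope_homs m s = {f \<in> {..<m} \<rightarrow>\<^sub>E pverts (net_graph q r). \<forall>i<m. int q dvd
     snd (f (Suc i mod m)) - snd (f i) - s i * (fst (f (Suc i mod m)) - fst (f i))}"

lemma finite_slope_homs: "finite (slope_homs m s)"
  by (rule finite_subset[of _ "{..<m} \<rightarrow>\<^sub>E pverts (net_graph q r)"])
     (auto simp: slope_homs_def intro!: finite_PiE)

lemma slope_homs_in_range:
  assumes "f \<in> slope_homs m s" "i < m"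
  shows "fst (f i) \<in> {0..<int q}" "snd (f i) \<in> {0..<int q}"
proof -
  have "f i \<in> {0..<int q} \<times> {0..<int q}"
    using assms by (auto simp: slope_homs_def)
  then show "fst (f i) \<in> {0..<int q}" "snd (f i) \<in> {0..<int q}"
    by (auto simp: mem_Times_iff)
qed

lemma slope_homs_diff_dvd:
  assumes "f \<in> slope_homs m s" "g \<in> slope_homs m s" "i < m"
  shows "int q dvd (snd (f (Suc i mod m)) - snd (g (Suc i mod m))) - (snd (f i) - snd (g i))
      - s i * ((fst (f (Suc i mod m)) - fst (g (Suc i mod m))) - (fst (f i) - fst (g i)))"
proof -
  have "int q dvd (snd (f (Suc i mod m)) - snd (f i) - s i * (fst (f (Suc i mod m)) - fst (f i)))
      - (snd (g (Suc i mod m)) - snd (g i) - s i * (fst (g (Suc i mod m)) - fst (g i)))"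
    by (rule dvd_diff) (use assms in \<open>simp_all add: slope_homs_def\<close>)
  then show ?thesis by (simp add: algebra_simps)
qed

text \<open>Slopes and first coordinates fix every increment of the second coordinate, so one second
  coordinate determines the rest.\<close>

lemma slope_homs_eqI:
  assumes f: "f \<in> slope_homs m s" and g: "g \<in> slope_homs m s"
    and fst_eq: "\<And>i. i < m \<Longrightarrow> fst (f i) = fst (g i)" and snd0: "snd (f 0) = snd (g 0)"
  shows "f = g"
proof (rule PiE_ext)
  show "f \<in> {..<m} \<rightarrow>\<^sub>E pverts (net_graph q r)" "g \<in> {..<m} \<rightarrow>\<^sub>E pverts (net_graph q r)"
    using f g by (simp_all add: slope_homs_def)
  have "snd (f i) = snd (g i)" if "i < m" for i
    using that
  proof (induction i)
    case (Suc i)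
    have "int q dvd snd (f (Suc i)) - snd (g (Suc i))"
      using slope_homs_diff_dvd[OF f g, of i] Suc fst_eq[of i] fst_eq[of "Suc i"] by simp
    then show ?case
      using slope_homs_in_range[OF f] slope_homs_in_range[OF g] Suc.prems by (intro residue_eqI) auto
  qed (rule snd0)
  then show "f i = g i" if "i \<in> {..<m}" for i
    using that fst_eq by (simp add: prod_eq_iff)
qed

lemma card_slope_homs_le:
  assumes "m \<ge> 1"
  shows "card (slope_homs m s) \<le> q ^ (m + 1)"
proof -
  let ?C = "({..<m} \<rightarrow>\<^sub>E {0..<int q}) \<times> {0..<int q}"
  have "card (slope_homs m s) \<le> card ?C"
  proof (rule card_inj_on_le[of "\<lambda>f. (restrict (fst \<circ> f) {..<m}, snd (f 0))"])
    show "inj_on (\<lambda>f. (restrict (fst \<circ> f) {..<m}, snd (f 0))) (slope_homs m s)"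
    proof (rule inj_onI, rule slope_homs_eqI)
      fix f g i
      assume eq: "(restrict (fst \<circ> f) {..<m}, snd (f 0)) = (restrict (fst \<circ> g) {..<m}, snd (g 0))"
        and "i < m"
      then show "fst (f i) = fst (g i)"
        by (auto dest!: fun_cong[of _ _ i])
    qed auto
    show "(\<lambda>f. (restrict (fst \<circ> f) {..<m}, snd (f 0))) ` slope_homs m s \<subseteq> ?C"
    proof (rule image_subsetI)
      fix f assume f: "f \<in> slope_homs m s"
      show "(restrict (fst \<circ> f) {..<m}, snd (f 0)) \<in> ?C"
        using slope_homs_in_range[OF f] assms by auto
    qed
  qed (auto intro!: finite_PiE)
  then show ?thesis
    by (simp add: card_cartesian_product card_PiE mult.commute)
qed

text \<open>
  Around the cycle the second coordinates telescope, so the \<open>s\<^sub>i\<close>-weighted increments of the first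
  coordinates sum to \<open>0\<close>. There the coordinate at \<open>i + 1\<close> has the coefficient \<open>s\<^sub>i - s\<^sub>i\<^sub>+\<^sub>1\<close>, a unit,
  so it is determined by the other first coordinates.
\<close>

lemma card_slope_homs_turn_le:
  assumes i: "Suc i < m" and s: "s i \<in> {0..<int r}" "s (Suc i) \<in> {0..<int r}" "s i \<noteq> s (Suc i)"
  shows "card (slope_homs m s) \<le> q ^ m"
proof -
  let ?I = "{..<m} - {Suc i}"
  let ?C = "(?I \<rightarrow>\<^sub>E {0..<int q}) \<times> {0..<int q}"
  have "card (slope_homs m s) \<le> card ?C"
  proof (rule card_inj_on_le[of "\<lambda>f. (restrict (fst \<circ> f) ?I, snd (f 0))"])
    show "inj_on (\<lambda>f. (restrict (fst \<circ> f) ?I, snd (f 0))) (slope_homs m s)"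
    proof (rule inj_onI)
      fix f g
      assume f: "f \<in> slope_homs m s" and g: "g \<in> slope_homs m s"
        and eq: "(restrict (fst \<circ> f) ?I, snd (f 0)) = (restrict (fst \<circ> g) ?I, snd (g 0))"
      have fst_eq: "fst (f j) = fst (g j)" if "j < m" "j \<noteq> Suc i" for j
        using eq that by (auto dest!: fun_cong[of _ _ j])
      \<comment> \<open>Reading indices modulo \<open>m\<close> makes \<open>b m = b 0\<close>, so
        the increments of \<open>b\<close> cancel in the sum around the cycle.\<close>
      define a where "a j = fst (f (j mod m)) - fst (g (j mod m))" for j
      define b where "b j = snd (f (j mod m)) - snd (g (j mod m))" for j
      have a0: "a j = 0" if "j mod m \<noteq> Suc i" for j
        using fst_eq[of "j mod m"] that i by (simp add: a_def)
      have "int q dvd (\<Sum>j<m. (b (Suc j) - b j) - s j * (a (Suc j) - a j))"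
        using slope_homs_diff_dvd[OF f g] by (intro dvd_sum) (auto simp: a_def b_def)
      also have "(\<Sum>j<m. (b (Suc j) - b j) - s j * (a (Suc j) - a j)) =
          - (\<Sum>j<m. s j * (a (Suc j) - a j))"
        by (subst sum_subtractf, subst sum_lessThan_telescope) (simp add: b_def)
      also have "(\<Sum>j<m. s j * (a (Suc j) - a j)) = (\<Sum>j\<in>{i, Suc i}. s j * (a (Suc j) - a j))"
      proof (rule sum.mono_neutral_right)
        show "\<forall>j\<in>{..<m} - {i, Suc i}. s j * (a (Suc j) - a j) = 0"
        proof
          fix j assume j: "j \<in> {..<m} - {i, Suc i}"
          then have "Suc j mod m \<noteq> Suc i"
            by (cases "Suc j = m") auto
          with j show "s j * (a (Suc j) - a j) = 0"
            by (simp add: a0)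
        qed
      qed (use i in auto)
      also have "\<dots> = (s i - s (Suc i)) * a (Suc i)"
      proof -
        have "Suc (Suc i) mod m \<noteq> Suc i"
          using i by (cases "Suc (Suc i) = m") auto
        then have "a (Suc (Suc i)) = 0" by (rule a0)
        moreover have "a i = 0" using i by (intro a0) simp
        ultimately show ?thesis by (simp add: algebra_simps)
      qed
      finally have "int q dvd (s i - s (Suc i)) * a (Suc i)" by simp
      then have "int q dvd a (Suc i)"
        using coprime_slopes[OF s] by (simp add: coprime_dvd_mult_right_iff)
      then have "fst (f (Suc i)) = fst (g (Suc i))"
        using slope_homs_in_range[OF f i] slope_homs_in_range[OF g i] i
        by (intro residue_eqI) (auto simp: a_def)
      then have "fst (f j) = fst (g j)" if "j < m" for j
        using fst_eq[OF that] by (cases "j = Suc i") auto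
      then show "f = g"
        using eq by (intro slope_homs_eqI[OF f g]) auto
    qed
    show "(\<lambda>f. (restrict (fst \<circ> f) ?I, snd (f 0))) ` slope_homs m s \<subseteq> ?C"
    proof (rule image_subsetI)
      fix f assume f: "f \<in> slope_homs m s"
      show "(restrict (fst \<circ> f) ?I, snd (f 0)) \<in> ?C"
        using slope_homs_in_range[OF f] i by auto
    qed
  qed (auto intro!: finite_PiE)
  also have "\<dots> = q ^ (m - 1) * q"
    using i by (simp add: card_cartesian_product card_PiE)
  also have "\<dots> = q ^ m"
    using i by (cases m) auto
  finally show ?thesis .
qed

text \<open>Sum over the slope sequences along the cycle. The at most \<open>r\<close> constant ones
  keep the image on one line and allow \<open>q ^ (m + 1)\<close> maps each; any other one has a
  turn, which costs a factor \<open>q\<close>.\<close>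

lemma hom_count_cycle_net_graph_le:
  assumes "m \<ge> 1"
  shows "hom_count (cycle_graph m) (net_graph q r) \<le> r * q ^ (m + 1) + r ^ m * q ^ m"
proof -
  let ?S = "{..<m} \<rightarrow>\<^sub>E {0..<int r}"
  define K where "K = (\<lambda>c. restrict (\<lambda>_. c) {..<m}) ` {0..<int r}"
  have finS: "finite ?S" by (auto intro!: finite_PiE)
  have "graph_homs (cycle_graph m) (net_graph q r) \<subseteq> (\<Union>s\<in>?S. slope_homs m s)"
  proof
    fix f assume f: "f \<in> graph_homs (cycle_graph m) (net_graph q r)"
    have "\<exists>s\<in>{0..<int r}. int q dvd
        snd (f (Suc i mod m)) - snd (f i) - s * (fst (f (Suc i mod m)) - fst (f i))" if "i < m" for i
    proof -
      have "(i, Suc i mod m) \<in> parcs (cycle_graph m)"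
        using that by (simp add: cycle_graph_def)
      then have "(f i, f (Suc i mod m)) \<in> parcs (net_graph q r)"
        using f by (auto simp: graph_homs_def)
      then show ?thesis by (simp add: net_graph_def)
    qed
    then obtain s where s: "\<And>i. i < m \<Longrightarrow> s i \<in> {0..<int r} \<and> int q dvd
        snd (f (Suc i mod m)) - snd (f i) - s i * (fst (f (Suc i mod m)) - fst (f i))"
      by metis
    moreover have "f \<in> {..<m} \<rightarrow>\<^sub>E pverts (net_graph q r)"
      using f by (simp add: graph_homs_def cycle_graph_def)
    ultimately have "f \<in> slope_homs m (restrict s {..<m})"
      by (simp add: slope_homs_def)
    moreover have "restrict s {..<m} \<in> ?S" using s by auto
    ultimately show "f \<in> (\<Union>s\<in>?S. slope_homs m s)" by blast
  qed
  then have "hom_count (cycle_graph m) (net_graph q r) \<le> card (\<Union>s\<in>?S. slope_homs m s)"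
    unfolding hom_count_def using finS finite_slope_homs by (intro card_mono) auto
  also have "\<dots> \<le> (\<Sum>s\<in>?S. card (slope_homs m s))"
    by (rule card_UN_le[OF finS])
  \<comment> \<open>Here \<open>K\<close> consists of the constant sequences. Granting them the
    extra \<open>q ^ m\<close> as well lets the sum split into the two terms of the bound.\<close>
  also have "\<dots> \<le> (\<Sum>s\<in>?S. (if s \<in> K then q ^ (m + 1) else 0) + q ^ m)"
  proof (rule sum_mono)
    fix s assume s: "s \<in> ?S"
    show "card (slope_homs m s) \<le> (if s \<in> K then q ^ (m + 1) else 0) + q ^ m"
    proof (cases "\<exists>i. Suc i < m \<and> s i \<noteq> s (Suc i)")
      case True
      then obtain i where i: "Suc i < m" "s i \<noteq> s (Suc i)" by blast
      have "s i \<in> {0..<int r}" "s (Suc i) \<in> {0..<int r}"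
        using i(1) PiE_mem[OF s, of i] PiE_mem[OF s, of "Suc i"] by auto
      then show ?thesis
        using card_slope_homs_turn_le[OF i(1) _ _ i(2)] by (simp add: trans_le_add2)
    next
      case False
      have const: "s i = s 0" if "i < m" for i
        using that
      proof (induction i)
        case (Suc i)
        then show ?case using False by (metis Suc_lessD)
      qed simp
      have "s = restrict (\<lambda>_. s 0) {..<m}"
      proof
        fix i show "s i = restrict (\<lambda>_. s 0) {..<m} i"
          using const[of i] PiE_arb[OF s, of i] by (cases "i < m") simp_all
      qed
      moreover have "s 0 \<in> {0..<int r}" using PiE_mem[OF s, of 0] assms by auto
      ultimately have "s \<in> K" unfolding K_def by (rule image_eqI)
      then show ?thesis using card_slope_homs_le[OF assms, of s] by simp
    qed
  qed
  also have "\<dots> = card (?S \<inter> K) * q ^ (m + 1) + r ^ m * q ^ m"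
    using finS by (simp add: sum.distrib card_PiE sum.If_cases)
  also have "card (?S \<inter> K) \<le> r"
  proof -
    have "card (?S \<inter> K) \<le> card K"
      by (rule card_mono) (simp_all add: K_def)
    also have "\<dots> \<le> r"
      unfolding K_def using card_image_le[of "{0..<int r}"] by simp
    finally show ?thesis .
  qed
  finally show ?thesis by simp
qed

text \<open>Place the vertices of \<open>H\<close> injectively on a line \<open>y = s x + c\<close>,
  which is a clique. There are \<open>r * q\<close> lines, and each of the \<open>l\<close> factors
  of the falling factorial is at least \<open>q / 2\<close>.\<close>

lemma hom_count_net_graph_ge:
  fixes H :: "'a pair_pre_digraph"
  assumes "pair_graph H" and l: "card (pverts H) = l" "l \<ge> 2" and ql: "q \<ge> 2 * l"
  shows "real (hom_count H (net_graph q r)) \<ge> real r * real q * (real q / 2) ^ l"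
proof -
  interpret H: pair_graph H by fact
  let ?V = "pverts H"
  let ?J = "{g \<in> ?V \<rightarrow>\<^sub>E {0..<int q}. inj_on g ?V}"
  let ?F = "\<lambda>(g, s, c). restrict (\<lambda>v. (g v, (s * g v + c) mod int q)) ?V"
  let ?D = "?J \<times> {0..<int r} \<times> {0..<int q}"
  have fin: "finite (graph_homs H (net_graph q r))"
    by (rule finite_subset[of _ "?V \<rightarrow>\<^sub>E pverts (net_graph q r)"])
       (auto simp: graph_homs_def intro!: finite_PiE)
  \<comment> \<open>Two points with different first coordinates recover the slope of the line; this
    is where \<open>l >= 2\<close> enters.\<close>
  obtain v w where vw: "v \<in> ?V" "w \<in> ?V" "v \<noteq> w"
    using l card_le_Suc0_iff_eq[OF H.pair_finite_verts] by fastforce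
  have "inj_on ?F ?D"
  proof (rule inj_onI)
    fix t t' assume D: "t \<in> ?D" "t' \<in> ?D" and F: "?F t = ?F t'"
    obtain g s c g' s' c' where t: "t = (g, s, c)" "t' = (g', s', c')"
      by (metis prod_cases3)
    have g: "g \<in> ?V \<rightarrow>\<^sub>E {0..<int q}" "inj_on g ?V" "g' \<in> ?V \<rightarrow>\<^sub>E {0..<int q}"
      and sc: "s \<in> {0..<int r}" "s' \<in> {0..<int r}" "c \<in> {0..<int q}" "c' \<in> {0..<int q}"
      and eq: "restrict (\<lambda>v. (g v, (s * g v + c) mod int q)) ?V =
        restrict (\<lambda>v. (g' v, (s' * g' v + c') mod int q)) ?V"
      using D F by (simp_all add: t)
    have eqs: "g x = g' x \<and> (s * g x + c) mod int q = (s' * g' x + c') mod int q" if "x \<in> ?V" for x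
      using fun_cong[OF eq, of x] that by auto
    have "g = g'"
      using eqs by (intro PiE_ext[OF g(1,3)]) simp
    have d: "int q dvd (s * g x + c) - (s' * g x + c')" if "x \<in> ?V" for x
      using eqs[OF that] \<open>g = g'\<close> by (simp add: mod_eq_dvd_iff)
    have "s = s'"
    proof (rule ccontr)
      assume "s \<noteq> s'"
      have "int q dvd ((s * g v + c) - (s' * g v + c')) - ((s * g w + c) - (s' * g w + c'))"
        by (rule dvd_diff) (use d vw in simp_all)
      also have "\<dots> = (s - s') * (g v - g w)" by (simp add: algebra_simps)
      finally have "int q dvd g v - g w"
        using coprime_slopes[OF sc(1,2) \<open>s \<noteq> s'\<close>] by (simp add: coprime_dvd_mult_right_iff)
      then have "g v = g w"
        using g(1) vw by (intro residue_eqI) auto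
      then show False using g(2) vw by (auto dest: inj_onD)
    qed
    moreover have "c = c'"
      using d[OF vw(1)] \<open>s = s'\<close> sc by (intro residue_eqI) auto
    ultimately show "t = t'" using \<open>g = g'\<close> by (simp add: t)
  qed
  moreover have "?F ` ?D \<subseteq> graph_homs H (net_graph q r)"
  proof (rule image_subsetI)
    fix t assume D: "t \<in> ?D"
    obtain g s c where t: "t = (g, s, c)"
      by (rule prod_cases3)
    have g: "g \<in> ?V \<rightarrow>\<^sub>E {0..<int q}" "inj_on g ?V" and sc: "s \<in> {0..<int r}"
      using D by (simp_all add: t)
    have arc: "((g x, (s * g x + c) mod int q), (g y, (s * g y + c) mod int q)) \<in> parcs (net_graph q r)"
      if "(x, y) \<in> parcs H" for x y
    proof -
      have xy: "x \<in> ?V" "y \<in> ?V" "x \<noteq> y"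
        using that H.in_arcsD1 H.in_arcsD2 H.no_loops' by auto
      have "int q dvd (s * g y + c) mod int q - (s * g x + c) mod int q - s * (g y - g x)"
      proof -
        have "((s * g y + c) mod int q - (s * g x + c) mod int q - s * (g y - g x)) mod int q =
            ((s * g y + c) - (s * g x + c) - s * (g y - g x)) mod int q"
          by (intro mod_diff_cong) auto
        then show ?thesis by (simp add: algebra_simps mod_eq_0_iff_dvd)
      qed
      moreover have "g x \<noteq> g y" using g(2) xy by (auto dest: inj_onD)
      moreover have "g x \<in> {0..<int q}" "g y \<in> {0..<int q}" using g(1) xy by auto
      ultimately show ?thesis
        using sc q_pos by (auto simp: net_graph_def)
    qed
    have "restrict (\<lambda>v. (g v, (s * g v + c) mod int q)) ?V \<in> ?V \<rightarrow>\<^sub>E pverts (net_graph q r)"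
      using PiE_mem[OF g(1)] q_pos by auto
    then show "?F t \<in> graph_homs H (net_graph q r)"
      using arc H.in_arcsD1 H.in_arcsD2 by (auto simp: t graph_homs_def)
  qed
  ultimately have le: "card ?D \<le> hom_count H (net_graph q r)"
    unfolding hom_count_def using fin by (intro card_inj_on_le)
  have card_D: "card ?D = (\<Prod>i\<in>{0..<l}. q - i) * (r * q)"
    using card_inj_on_subset_funcset[of ?V "{0..<int q}" ?V] l
    by (simp add: card_cartesian_product)
  have "(\<Prod>i\<in>{0..<l}. real q / 2) \<le> (\<Prod>i\<in>{0..<l}. real (q - i))"
    using ql by (intro prod_mono) (auto simp: of_nat_diff)
  then have "real r * real q * (real q / 2) ^ l \<le> real r * real q * real (\<Prod>i\<in>{0..<l}. q - i)"
    by (intro mult_left_mono) auto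
  also have "\<dots> = real (card ?D)" by (simp add: card_D)
  finally show ?thesis using le by linarith
qed

end

section \<open>Lower bound for the exponent\<close>

lemma slope_net_prime_power:
  assumes "prime p"
  shows "slope_net (p ^ n) p"
proof
  show "p ^ n > 0" using assms by (simp add: prime_gt_0_nat)
next
  fix s s' :: int
  assume s: "s \<in> {0..<int p}" "s' \<in> {0..<int p}" "s \<noteq> s'"
  then have "\<not> int p dvd s - s'"
    using residue_eqI by blast
  then have "coprime (int p) (s - s')"
    using assms by (intro prime_imp_coprime) auto
  then show "coprime (int (p ^ n)) (s - s')" by simp
qed

lemma hom_density_le_1:
  assumes "pair_graph H" "pair_graph T"
  shows "hom_density H T \<le> 1"
proof -
  interpret H: pair_graph H by fact
  interpret T: pair_graph T by fact
  have "hom_count H T \<le> card (pverts H \<rightarrow>\<^sub>E pverts T)"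
    unfolding hom_count_def by (rule card_mono) (auto simp: graph_homs_def intro!: finite_PiE)
  then have "real (hom_count H T) \<le> real (card (pverts T)) ^ card (pverts H)"
    by (simp add: card_PiE flip: of_nat_power)
  then show ?thesis by (auto simp: hom_density_def divide_le_eq_1 card_gt_0_iff)
qed

text \<open>For the net with \<open>q = p ^ (2 * k - 1)\<close> and \<open>p\<close> slopes, the
  cycle density is at most \<open>2 * p powr (- ?M)\<close>, and the density of \<open>H\<close> is
  at least \<open>2 powr (- l) * p powr (- ?N)\<close>. Large primes \<open>p\<close> then force
  \<open>?M <= c * ?N\<close>.\<close>

lemma admissible_exponent_ge:
  fixes k l :: nat and H :: "'a pair_pre_digraph"
  assumes k: "k \<ge> 2" and l: "l \<ge> 2" and H: "pair_graph H" "card (pverts H) = l"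
    and c: "c \<in> admissible_exponents (cycle_graph (2 * k)) H"
  shows "4 * real k * (real k - 1) \<le> c * (2 * real k * real l - 2 * real k - real l)"
proof -
  let ?M = "4 * real k * (real k - 1)" and ?N = "2 * real k * real l - 2 * real k - real l"
  have M: "?M \<ge> 8"
    using mult_mono[of 8 "4 * real k" 1 "real k - 1"] k by simp
  have key: "c * ln (hom_density H T) \<le> ln 2 - ?M * ln p \<and> ln (hom_density H T) \<le> 0 \<and>
      - real l * ln 2 - ?N * ln p \<le> ln (hom_density H T)"
    if p: "prime p" "p \<ge> 2 * l" and T0: "T = net_graph (p ^ (2 * k - 1)) p" for p T
  proof -
    define q where "q = p ^ (2 * k - 1)"
    interpret slope_net q p unfolding q_def by (rule slope_net_prime_power[OF p(1)])
    have T: "T = net_graph q p" by (simp add: T0 q_def)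
    have p0: "real p > 0" using p by (simp add: prime_gt_0_nat)
    have lnq: "ln (real q) = (2 * real k - 1) * ln (real p)"
      using p0 k by (simp add: q_def ln_realpow of_nat_diff)
    have "p ^ 1 \<le> p ^ (2 * k - 1)" using p0 k by (intro power_increasing) auto
    then have ql: "q \<ge> 2 * l" using p(2) by (simp add: q_def)
    \<comment> \<open>This identity explains the choice of \<open>q\<close>: it makes the
      contributions of constant and turning slope sequences equal.\<close>
    have pm: "p ^ (2 * k) = p * q" using k by (simp add: q_def flip: power_Suc)
    have n: "real (card (pverts T)) = real q ^ 2" and ne: "pverts T \<noteq> {}" and gT: "pair_graph T"
      using q_pos pair_graph_net_graph by (auto simp: T card_cartesian_product power2_eq_square)
    have "real (hom_count (cycle_graph (2 * k)) T) \<le>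
        real (p * q ^ (2 * k + 1) + p ^ (2 * k) * q ^ (2 * k))"
      unfolding of_nat_le_iff T
      using k by (intro hom_count_cycle_net_graph_le) simp
    also have "\<dots> = 2 * real p * real q ^ (2 * k + 1)"
      by (simp add: pm)
    finally have "hom_density (cycle_graph (2 * k)) T \<le> 2 * real p * real q ^ (2 * k + 1) / (real q ^ 2) ^ (2 * k)"
      by (simp add: hom_density_def n cycle_graph_def divide_right_mono)
    also have "\<dots> = exp (ln (2 * real p * real q ^ (2 * k + 1) / (real q ^ 2) ^ (2 * k)))"
      using p0 q_pos by simp
    also have "ln (2 * real p * real q ^ (2 * k + 1) / (real q ^ 2) ^ (2 * k)) =
        ln 2 + ln p + (2 * real k + 1) * ln q - 4 * real k * ln q"
      using p0 q_pos by (simp add: ln_mult ln_div ln_realpow del: power_Suc)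
    also have "\<dots> = ln 2 - ?M * ln p"
      unfolding lnq by (simp add: algebra_simps)
    finally have up: "hom_density (cycle_graph (2 * k)) T \<le> exp (ln 2 - ?M * ln p)" .
    have "real p * real q * (real q / 2) ^ l / (real q ^ 2) ^ l \<le> hom_density H T"
      using hom_count_net_graph_ge[OF H l ql]
      by (simp only: hom_density_def n H(2)) (simp add: T divide_right_mono)
    moreover have pos: "real p * real q * (real q / 2) ^ l / (real q ^ 2) ^ l > 0"
      using p0 q_pos by simp
    ultimately have "ln (real p * real q * (real q / 2) ^ l / (real q ^ 2) ^ l) \<le> ln (hom_density H T)"
      and tpos: "hom_density H T > 0"
      by (auto intro: ln_mono)
    moreover have "ln (real p * real q * (real q / 2) ^ l / (real q ^ 2) ^ l) =
        ln p + ln q + real l * (ln q - ln 2) - 2 * real l * ln q"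
      using p0 q_pos by (simp add: ln_mult ln_div ln_realpow)
    moreover have "\<dots> = - real l * ln 2 - ?N * ln p"
      unfolding lnq by (simp add: algebra_simps)
    ultimately have low: "- real l * ln 2 - ?N * ln p \<le> ln (hom_density H T)"
      by simp
    have "exp (c * ln (hom_density H T)) \<le> hom_density (cycle_graph (2 * k)) T"
      using admissible_exponents_any_type[OF pair_graph_cycle_graph H(1) gT ne c] k tpos
      by (simp add: powr_def)
    with up have "c * ln (hom_density H T) \<le> ln 2 - ?M * ln p"
      by (meson exp_le_cancel_iff order_trans)
    moreover have "ln (hom_density H T) \<le> 0"
      using hom_density_le_1[OF H(1) gT] tpos by simp
    ultimately show ?thesis using low by blast
  qed
  \<comment> \<open>The sign is needed before a lower bound on the logarithm of the density of
    \<open>H\<close> can be multiplied by \<open>c\<close>. A negative \<open>c\<close> would make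
    the power at least 1, while the cycle density is below 1 for large \<open>p\<close>.\<close>
  have c0: "c \<ge> 0"
  proof (rule ccontr)
    assume "\<not> c \<ge> 0"
    obtain p :: nat where p: "prime p" "p > 2 * l" using bigger_prime by blast
    have "0 \<le> ln 2 - ?M * ln p"
    proof -
      let ?t = "ln (hom_density H (net_graph (p ^ (2 * k - 1)) p))"
      have "c * ?t \<le> ln 2 - ?M * ln p" "?t \<le> 0"
        using key[OF p(1) less_imp_le[OF p(2)] refl] by blast+
      moreover from this(2) have "c * ?t \<ge> 0"
        using \<open>\<not> c \<ge> 0\<close> by (intro mult_nonpos_nonpos) auto
      ultimately show ?thesis by linarith
    qed
    moreover have "ln 2 < ln (real p)"
      using p l by simp
    moreover have "1 * ln (real p) \<le> ?M * ln p"
      using M p l by (intro mult_right_mono) auto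
    ultimately show False by simp
  qed
  show ?thesis
  proof (rule ccontr)
    assume "\<not> ?thesis"
    then have pos: "?M - c * ?N > 0" by simp
    \<comment> \<open>If \<open>?M > c * ?N\<close>, the two bounds, linear in \<open>ln p\<close>,
      cross at \<open>B\<close>; a prime beyond \<open>exp B\<close> violates them.\<close>
    define B where "B = (ln 2 + c * real l * ln 2) / (?M - c * ?N)"
    obtain p :: nat where p: "prime p" "p > max (2 * l) (nat \<lceil>exp B\<rceil>)" using bigger_prime by blast
    then have "exp B < real p" by linarith
    then have "ln (exp B) < ln (real p)"
      using p(1) by (subst ln_less_cancel_iff) (auto simp: prime_gt_0_nat)
    then have "B < ln (real p)" by simp
    then have "ln 2 + c * real l * ln 2 < (?M - c * ?N) * ln p"
      using pos by (simp add: B_def pos_divide_less_eq mult.commute)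
    moreover have "c * (- real l * ln 2 - ?N * ln p) \<le> ln 2 - ?M * ln p"
    proof -
      have "p \<ge> 2 * l" using p(2) by simp
      from key[OF p(1) this refl] mult_left_mono[OF _ c0] show ?thesis
        by (meson order_trans)
    qed
    ultimately show False by (simp add: algebra_simps)
  qed
qed

text \<open>The first conjunct asserts that a minimum is attained, so the \<open>LEAST\<close> in
  \<open>domination_exponent\<close> is a genuine minimum and not an unspecified value.\<close>

theorem theorem4p2:
  fixes k l :: nat and H :: "'a pair_pre_digraph"
  assumes "k \<ge> 2" and "l \<ge> 2" and "2 * k \<ge> l"
    and "pair_graph H" and "card (pverts H) = l" and "hamiltonian H"
  shows "(\<exists>m \<in> admissible_exponents (cycle_graph (2 * k)) H.
            \<forall>c \<in> admissible_exponents (cycle_graph (2 * k)) H. m \<le> c) \<and>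
         domination_exponent (cycle_graph (2 * k)) H =
           4 * real k * (real k - 1) / (2 * real k * real l - 2 * real k - real l)"
proof -
  let ?c = "4 * real k * (real k - 1) / (2 * real k * real l - 2 * real k - real l)"
  let ?A = "admissible_exponents (cycle_graph (2 * k)) H"
  have mem: "?c \<in> ?A"
    unfolding admissible_exponents_def
    by (intro CollectI allI impI cycle_density_ge_hamiltonian_density_powr) (use assms in auto)
  have "?c \<le> c" if "c \<in> ?A" for c
    using admissible_exponent_ge[OF assms(1,2,4,5) that] exponent_denominator_pos[OF assms(1,2)]
    by (simp add: pos_divide_le_eq)
  with mem show ?thesis
    unfolding domination_exponent_def by (auto intro!: Least_equality)
qed


end
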